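(* Let $\mathcal{G}=(V,(V_1,V_2,V_P),\delta)$ with reward function $r$ be a stochastic game with rewards that is stopping under fairness, and let $\nu\Gamma$ be the greatest fixed point of the functional $\Gamma$ defined below. Then for every $v\in V$, $\inf_{\pi_2\in\Pi_2^{F}}\sup_{\pi_1\in\Pi_1}\mathbb{E}^{\pi_1,\pi_2}_{\mathcal{G},v}[\mathrm{rew}]=\sup_{\pi_1\in\Pi_1}\inf_{\pi_2\in\Pi_2^{F}}\mathbb{E}^{\pi_1,\pi_2}_{\mathcal{G},v}[\mathrm{rew}]=\nu\Gamma(v)$, where $\Pi_1$ is the set of all Player 1 strategies and $\Pi_2^F$ the set of fair Player 2 strategies.
   Context: A stochastic game is a tuple $\mathcal{G}=(V,(V_1,V_2,V_P),\delta)$ where $V$ is a finite set of vertices, $V_1,V_2,V_P$ form a partition of $V$, and $\delta:V\times V\to[0,1]$ satisfies $\delta(v,v')\in\{0,1\}$ for $v\in V_1\cup V_2$, $v'\in V$, and $\delta(v,\cdot)$ is a probability distribution on $V$ for $v\in V_P$. Let $\mathrm{post}(v)=\{v'\mid \delta(v,v')>0\}$; it is assumed $\mathrm{post}(v)\neq\emptyset$ for all $v$. A vertex $v$ is terminal if $\delta(v,v)=1$ and $\delta(v,v')=0$ for $v'\neq v$; $T$ is the set of terminal vertices. A path is an infinite sequence $\omega=v_0v_1\dots$ with $\delta(v_k,v_{k+1})>0$ for all $k$; $\inf(\omega)$ is the set of vertices occurring infinitely often in $\omega$. A strategy for Player $i\in\{1,2\}$ is a function $\pi_i:V^*V_i\to\mathcal{D}(V)$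 with $\pi_i(\hat\omega u)(u')>0$ only if $u'\in\mathrm{post}(u)$; it is memoryless if $\pi_i(\hat\omega u)$ depends only on $u$, and deterministic if every $\pi_i(\hat\omega u)$ is a Dirac distribution. Given strategies $\pi_1,\pi_2$ and initial vertex $v$, $\Pr^{\pi_1,\pi_2}_{\mathcal{G},v}$ is the induced probability measure on paths starting at $v$. $\Diamond T$ is the set of paths visiting $T$. Fair plays: $FP^2=\{\omega\mid \forall v'\in V_2:\ v'\in\inf(\omega)\Rightarrow \mathrm{post}(v')\subseteq\inf(\omega)\}$; a Player 2 strategy $\pi_2$ is fair if $\Pr^{\pi_1,\pi_2}_{\mathcal{G},u}(FP^2)=1$ for every Player 1 strategy $\pi_1$ and every $u\in V$. $\mathcal{G}$ is stopping under fairness if $\Pr^{\pi_1,\pi_2}_{\mathcal{G},u}(\Diamond T)=1$ for all Player 1 strategies $\pi_1$, all fair Player 2 strategies $\pi_2$, and all $u\in V$. A stochastic game with rewards additionally has a reward function $r:V\to\mathbb{R}_{\ge0}$ with $r(u)=0$ for every terminal $u$; $\mathrm{rew}(\omega)=\sum_{i\ge0}r(\omega_i)$ and $\mathbb{E}^{\pi_1,\pi_2}_{\mathcal{G},v}[\mathrm{rew}]$ is the expectation of $\mathrm{rew}$ under $\Pr^{\pi_1,\pi_2}_{\mathcal{G},v}$. Let $\mathbf{U}=\max_{v\in V}\inf_{\pi_2\in\Pi_2^{DMF}}\sup_{\pi_1\in\Pi_1^{DM}}\mathbb{E}^{\pi_1,\pi_2}_{\mathcal{G},v}[\mathrm{rew}]$,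 where $\Pi_1^{DM}$ is the set of deterministic memoryless Player 1 strategies and $\Pi_2^{DMF}$ the set of deterministic memoryless fair Player 2 strategies. The functional $\Gamma:[0,\mathbf{U}]^V\to[0,\mathbf{U}]^V$ is defined by $\Gamma(f)(v)=r(v)+\sum_{v'\in\mathrm{post}(v)}\delta(v,v')f(v')$ if $v\in V_P\setminus T$; $\Gamma(f)(v)=\max\{r(v)+f(v')\mid v'\in\mathrm{post}(v)\}$ if $v\in V_1\setminus T$; $\Gamma(f)(v)=\min\{r(v)+f(v')\mid v'\in\mathrm{post}(v)\}$ if $v\in V_2\setminus T$; $\Gamma(f)(v)=0$ if $v\in T$. $\Gamma$ is monotone on the complete lattice $([0,\mathbf{U}]^V,\le)$ (pointwise order), and $\nu\Gamma$ denotes its greatest fixed point. *)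

theory Defs
  imports "HOL-Probability.Probability"
begin

text \<open>
  The vertex set \<open>V\<close> is the universe of a finite type \<open>'v\<close>, so that \<open>'v \<Rightarrow> real\<close>
  with the order of \<^theory>\<open>HOL.Orderings\<close> on functions is \<open>\<real>\<^sup>V\<close> with the pointwise order.
\<close>

record 'v game =
  V1 :: "'v set"
  V2 :: "'v set"
  VP :: "'v set"
  delta :: "'v \<Rightarrow> 'v \<Rightarrow> real"

definition post :: "'v game \<Rightarrow> 'v \<Rightarrow> 'v set" where
  "post G v = {v'. delta G v v' > 0}"

definition stochastic_game :: "'v::finite game \<Rightarrow> bool" where
  "stochastic_game G \<longleftrightarrow>
     V1 G \<union> V2 G \<union> VP G = UNIV \<and>
     V1 G \<inter> V2 G = {} \<and> V1 G \<inter> VP G = {} \<and> V2 G \<inter> VP G = {} \<and>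
     (\<forall>v v'. 0 \<le> delta G v v' \<and> delta G v v' \<le> 1) \<and>
     (\<forall>v \<in> V1 G \<union> V2 G. \<forall>v'. delta G v v' \<in> {0, 1}) \<and>
     (\<forall>v \<in> VP G. (\<Sum>v'\<in>UNIV. delta G v v') = 1) \<and>
     (\<forall>v. post G v \<noteq> {})"

definition terminal :: "'v game \<Rightarrow> 'v set" where
  "terminal G = {v. delta G v v = 1 \<and> (\<forall>v'. v' \<noteq> v \<longrightarrow> delta G v v' = 0)}"

definition reward_function :: "'v game \<Rightarrow> ('v \<Rightarrow> real) \<Rightarrow> bool" where
  "reward_function G r \<longleftrightarrow> (\<forall>v. 0 \<le> r v) \<and> (\<forall>v \<in> terminal G. r v = 0)"


section \<open>Paths and strategies\<close>

definition paths :: "'v game \<Rightarrow> (nat \<Rightarrow> 'v) set" where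
  "paths G = {\<omega>. \<forall>k. delta G (\<omega> k) (\<omega> (Suc k)) > 0}"

definition inf_vertices :: "(nat \<Rightarrow> 'v) \<Rightarrow> 'v set" where
  "inf_vertices \<omega> = {v. \<exists>\<^sub>\<infinity>k. \<omega> k = v}"

definition reach_terminal :: "'v game \<Rightarrow> (nat \<Rightarrow> 'v) set" where
  "reach_terminal G = {\<omega> \<in> paths G. \<exists>k. \<omega> k \<in> terminal G}"

definition fair_plays :: "'v game \<Rightarrow> (nat \<Rightarrow> 'v) set" where
  "fair_plays G = {\<omega> \<in> paths G. \<forall>v' \<in> V2 G. v' \<in> inf_vertices \<omega> \<longrightarrow> post G v' \<subseteq> inf_vertices \<omega>}"

text \<open>
  The distribution chosen after the word \<open>h u\<close>, for \<open>h \<in> V\<^sup>*\<close> and \<open>u\<close> a vertex of the player,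
  is \<open>\<pi> h u\<close>. The values at vertices \<open>u\<close> not belonging to the player are irrelevant.
\<close>

type_synonym 'v strategy = "'v list \<Rightarrow> 'v \<Rightarrow> 'v pmf"

definition strategies :: "'v game \<Rightarrow> 'v set \<Rightarrow> 'v strategy set" where
  "strategies G W = {\<pi>. \<forall>h. \<forall>u \<in> W. set_pmf (\<pi> h u) \<subseteq> post G u}"

definition memoryless :: "'v set \<Rightarrow> 'v strategy \<Rightarrow> bool" where
  "memoryless W \<pi> \<longleftrightarrow> (\<forall>u \<in> W. \<forall>h h'. \<pi> h u = \<pi> h' u)"

definition deterministic :: "'v set \<Rightarrow> 'v strategy \<Rightarrow> bool" where
  "deterministic W \<pi> \<longleftrightarrow> (\<forall>u \<in> W. \<forall>h. \<exists>u'. \<pi> h u = return_pmf u')"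


section \<open>The induced probability measure on paths\<close>

definition next_vertex ::
    "'v::finite game \<Rightarrow> 'v strategy \<Rightarrow> 'v strategy \<Rightarrow> 'v list \<Rightarrow> 'v \<Rightarrow> 'v pmf" where
  "next_vertex G \<pi>1 \<pi>2 h u =
     (if u \<in> V1 G then \<pi>1 h u else if u \<in> V2 G then \<pi>2 h u else embed_pmf (delta G u))"

text \<open>Conditional distribution of the \<open>n\<close>-th vertex given the vertices at positions below \<open>n\<close>.\<close>

definition path_kernel ::
    "'v::finite game \<Rightarrow> 'v strategy \<Rightarrow> 'v strategy \<Rightarrow> 'v \<Rightarrow> nat \<Rightarrow> (nat \<Rightarrow> 'v) \<Rightarrow> 'v measure" where
  "path_kernel G \<pi>1 \<pi>2 v n \<omega> =
     measure_pmf (case n of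
         0 \<Rightarrow> return_pmf v
       | Suc k \<Rightarrow> next_vertex G \<pi>1 \<pi>2 (map \<omega> [0..<k]) (\<omega> k))"

definition path_measure ::
    "'v::finite game \<Rightarrow> 'v strategy \<Rightarrow> 'v strategy \<Rightarrow> 'v \<Rightarrow> (nat \<Rightarrow> 'v) measure" where
  "path_measure G \<pi>1 \<pi>2 v =
     projective_family.lim UNIV
       (Ionescu_Tulcea.CI (path_kernel G \<pi>1 \<pi>2 v) (\<lambda>_. count_space UNIV))
       (\<lambda>_. count_space UNIV)"

lemma Ionescu_Tulcea_path_kernel:
  "Ionescu_Tulcea (path_kernel G \<pi>1 \<pi>2 v) (\<lambda>_. count_space UNIV)"
proof (rule Ionescu_Tulcea.intro)
  fix i :: nat and \<omega> :: "nat \<Rightarrow> 'a"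
  have eq: "PiM {0..<i} (\<lambda>_. count_space (UNIV :: 'a set)) = count_space (PiE {0..<i} (\<lambda>_. UNIV))"
    by (rule count_space_PiM_finite) auto
  show "path_kernel G \<pi>1 \<pi>2 v i
      \<in> measurable (PiM {0..<i} (\<lambda>_. count_space UNIV)) (subprob_algebra (count_space UNIV))"
    unfolding eq
    by (auto simp: path_kernel_def space_subprob_algebra prob_space_imp_subprob_space
        measure_pmf.prob_space_axioms)
  show "prob_space (path_kernel G \<pi>1 \<pi>2 v i \<omega>)"
    by (simp add: path_kernel_def measure_pmf.prob_space_axioms)
qed


section \<open>Fairness\<close>

definition strategies1 :: "'v game \<Rightarrow> 'v strategy set" where
  "strategies1 G = strategies G (V1 G)"

definition strategies1_DM :: "'v game \<Rightarrow> 'v strategy set" where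
  "strategies1_DM G = {\<pi>1 \<in> strategies1 G. deterministic (V1 G) \<pi>1 \<and> memoryless (V1 G) \<pi>1}"

definition strategies2 :: "'v game \<Rightarrow> 'v strategy set" where
  "strategies2 G = strategies G (V2 G)"

definition strategies2_F :: "'v::finite game \<Rightarrow> 'v strategy set" where
  "strategies2_F G = {\<pi>2 \<in> strategies2 G.
     \<forall>\<pi>1 \<in> strategies1 G. \<forall>u. measure (path_measure G \<pi>1 \<pi>2 u) (fair_plays G) = 1}"

definition strategies2_DMF :: "'v::finite game \<Rightarrow> 'v strategy set" where
  "strategies2_DMF G = {\<pi>2 \<in> strategies2_F G. deterministic (V2 G) \<pi>2 \<and> memoryless (V2 G) \<pi>2}"

definition stopping_under_fairness :: "'v::finite game \<Rightarrow> bool" where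
  "stopping_under_fairness G \<longleftrightarrow>
     (\<forall>\<pi>1 \<in> strategies1 G. \<forall>\<pi>2 \<in> strategies2_F G. \<forall>u.
        measure (path_measure G \<pi>1 \<pi>2 u) (reach_terminal G) = 1)"


section \<open>Expected total reward and the functional\<close>

text \<open>
  Total rewards take values in \<^typ>\<open>ennreal\<close>: a fair strategy with memory may have infinite expected
  reward even in a game that is stopping under fairness.
\<close>

definition rew :: "('v \<Rightarrow> real) \<Rightarrow> (nat \<Rightarrow> 'v) \<Rightarrow> ennreal" where
  "rew r \<omega> = (\<Sum>i. ennreal (r (\<omega> i)))"

definition expected_rew ::
    "'v::finite game \<Rightarrow> ('v \<Rightarrow> real) \<Rightarrow> 'v strategy \<Rightarrow> 'v strategy \<Rightarrow> 'v \<Rightarrow> ennreal" where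
  "expected_rew G r \<pi>1 \<pi>2 v = (\<integral>\<^sup>+\<omega>. rew r \<omega> \<partial>path_measure G \<pi>1 \<pi>2 v)"

definition upper_bound :: "'v::finite game \<Rightarrow> ('v \<Rightarrow> real) \<Rightarrow> ennreal" where
  "upper_bound G r =
     Max (range (\<lambda>v. INF \<pi>2 \<in> strategies2_DMF G. SUP \<pi>1 \<in> strategies1_DM G. expected_rew G r \<pi>1 \<pi>2 v))"

definition \<Gamma> :: "'v::finite game \<Rightarrow> ('v \<Rightarrow> real) \<Rightarrow> ('v \<Rightarrow> real) \<Rightarrow> 'v \<Rightarrow> real" where
  "\<Gamma> G r f v =
     (if v \<in> terminal G then 0
      else if v \<in> VP G then r v + (\<Sum>v' \<in> post G v. delta G v v' * f v')
      else if v \<in> V1 G then Max {r v + f v' | v'. v' \<in> post G v}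
      else Min {r v + f v' | v'. v' \<in> post G v})"

text \<open>
  The lattice \<open>[0, U]\<^sup>V\<close>, with \<open>U\<close> the upper bound above. The formula for \<^const>\<open>\<Gamma>\<close> by itself
  does not force values below \<open>U\<close>; the greatest fixed point is the greatest one among the
  fixed points that lie in this lattice.
\<close>

definition value_lattice :: "'v::finite game \<Rightarrow> ('v \<Rightarrow> real) \<Rightarrow> ('v \<Rightarrow> real) set" where
  "value_lattice G r = {f. \<forall>v. 0 \<le> f v \<and> ennreal (f v) \<le> upper_bound G r}"

definition nu_\<Gamma> :: "'v::finite game \<Rightarrow> ('v \<Rightarrow> real) \<Rightarrow> 'v \<Rightarrow> real" where
  "nu_\<Gamma> G r = (GREATEST f. f \<in> value_lattice G r \<and> \<Gamma> G r f = f)"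

end

theory Submission
  imports Defs
begin

text \<open>
  Call \<open>g \<ge> 0\<close> strictly superharmonic if \<open>\<Gamma> g + \<epsilon> \<le> g\<close> off the terminal vertices for some \<open>\<epsilon> > 0\<close>.
  Against any opponent, the positional \<open>g\<close>-minimising strategy of Player 2 makes \<open>g\<close> a supermartingale
  that loses the reward plus \<open>\<epsilon>\<close> per step; hence it stops almost surely, which makes it fair, and its
  expected reward is at most \<open>g\<close>. Conversely, for a fixed point \<open>f \<ge> 0\<close> of \<open>\<Gamma>\<close> the positional
  \<open>f\<close>-maximising strategy of Player 1 makes \<open>f\<close> plus the collected reward a submartingale, and \<open>f\<close> vanishes
  in the limit since play against a fair opponent stops; so it earns at least \<open>f\<close>. The infimum \<open>h\<close> of the
  strictly superharmonic functions is itself a fixed point of \<open>\<Gamma>\<close>, so both values equal \<open>h\<close>, and every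
  other fixed point lies below \<open>h\<close>. Strictly superharmonic functions exist because otherwise Player 1
  could trap the play outside the terminal vertices.
\<close>

section \<open>Finite prefixes of an Ionescu-Tulcea limit measure\<close>

context Ionescu_Tulcea
begin

lemma CI_atLeastLessThan: "CI {0..<n} = C 0 n (\<lambda>_. undefined)"
proof -
  have "up_to {0..<n} = n"
    unfolding up_to_def by (rule Least_equality) (auto simp: not_le[symmetric])
  then show ?thesis
    using distr_C[of n n "\<lambda>_. undefined" 0] by (simp add: CI_def)
qed

lemma nn_integral_lim_restrict:
  assumes f: "f \<in> borel_measurable (PiM {0..<n} M)"
  shows "(\<integral>\<^sup>+\<omega>. f (restrict \<omega> {0..<n}) \<partial>PF.lim) = (\<integral>\<^sup>+\<omega>. f \<omega> \<partial>C 0 n (\<lambda>_. undefined))"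
proof -
  have "(\<integral>\<^sup>+\<omega>. f \<omega> \<partial>C 0 n (\<lambda>_. undefined)) =
      (\<integral>\<^sup>+\<omega>. f \<omega> \<partial>distr PF.lim (PiM {0..<n} M) (\<lambda>x. restrict x {0..<n}))"
    by (simp add: distr_lim CI_atLeastLessThan)
  also have "\<dots> = (\<integral>\<^sup>+\<omega>. f (restrict \<omega> {0..<n}) \<partial>PF.lim)"
    using f by (intro nn_integral_distr)
      (auto simp: measurable_cong_sets[OF PF.sets_lim refl] intro!: measurable_restrict_subset)
  finally show ?thesis ..
qed

text \<open>On prefixes, \<open>C 0 (Suc n)\<close> is \<open>C 0 n\<close> followed by the kernel
  for coordinate \<open>n\<close>. Every property of the path measure below is derived from this
  disintegration.\<close>

lemma nn_integral_lim_step: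
  assumes f[measurable]: "f \<in> borel_measurable (PiM {0..<Suc n} M)"
  shows "(\<integral>\<^sup>+\<omega>. f (restrict \<omega> {0..<Suc n}) \<partial>PF.lim) =
    (\<integral>\<^sup>+\<omega>. (\<integral>\<^sup>+x. f (fun_upd (restrict \<omega> {0..<n}) n x) \<partial>P n (restrict \<omega> {0..<n})) \<partial>PF.lim)"
proof -
  have [simp]: "(\<lambda>_. undefined) \<in> space (PiM {0..<0} M)"
    by (simp add: space_PiM)
  have "(\<integral>\<^sup>+\<omega>. f (restrict \<omega> {0..<Suc n}) \<partial>PF.lim) =
      (\<integral>\<^sup>+\<omega>. (\<integral>\<^sup>+\<omega>'. f \<omega>' \<partial>eP n \<omega>) \<partial>C 0 n (\<lambda>_. undefined))"
    by (simp add: nn_integral_lim_restrict nn_integral_bind[where B="PiM {0..<Suc n} M"]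
        measurable_cong_sets[OF sets_C refl])
  also have "\<dots> = (\<integral>\<^sup>+\<omega>. (\<integral>\<^sup>+x. f (fun_upd \<omega> n x) \<partial>P n \<omega>) \<partial>C 0 n (\<lambda>_. undefined))"
    by (intro nn_integral_cong) (simp add: nn_integral_eP space_C)
  also have "\<dots> = (\<integral>\<^sup>+\<omega>. (\<integral>\<^sup>+x. f (fun_upd (restrict \<omega> {0..<n}) n x)
      \<partial>P n (restrict \<omega> {0..<n})) \<partial>PF.lim)"
  proof (rule nn_integral_lim_restrict[symmetric])
    \<comment> \<open>Measurability is available for the kernel \<open>eP\<close> on prefixes; the
      integral over \<open>P n\<close> agrees with it on the space of the finite product.\<close>
    have "(\<lambda>\<omega>. \<integral>\<^sup>+\<omega>'. f \<omega>' \<partial>eP n \<omega>) \<in> borel_measurable (PiM {0..<n} M)"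
      by measurable
    then show "(\<lambda>\<omega>. \<integral>\<^sup>+x. f (fun_upd \<omega> n x) \<partial>P n \<omega>) \<in> borel_measurable (PiM {0..<n} M)"
      by (rule measurable_cong[THEN iffD1, rotated]) (simp add: nn_integral_eP)
  qed
  finally show ?thesis .
qed

text \<open>The total mass is read off from the cylinder over the empty index set, which is the
  whole space.\<close>

lemma prob_space_lim: "prob_space PF.lim"
proof
  interpret CI: prob_space "CI {}"
    by (rule PF.prob_space_P) simp_all
  have "emeasure PF.lim (PF.emb UNIV {} (space (PiM {} M))) = 1"
    using CI.emeasure_space_1 by (subst lim) (auto simp: CI_def)
  then show "emeasure PF.lim (space PF.lim) = 1"
    by (simp add: prod_emb_def space_PiM PiE_def Pi_def extensional_def restrict_def)
qed

end

section \<open>The path measure: one-step integrals and almost sure behaviour\<close>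

lemma sets_path_measure[measurable_cong]:
  "sets (path_measure G \<pi>1 \<pi>2 v) = sets (PiM UNIV (\<lambda>_. count_space UNIV))"
proof -
  interpret IT: Ionescu_Tulcea "path_kernel G \<pi>1 \<pi>2 v" "\<lambda>_. count_space UNIV"
    by (rule Ionescu_Tulcea_path_kernel)
  show ?thesis by (simp add: path_measure_def)
qed

lemma space_path_measure[simp]: "space (path_measure G \<pi>1 \<pi>2 v) = UNIV"
  using sets_path_measure[THEN sets_eq_imp_space_eq, of G \<pi>1 \<pi>2 v] by (simp add: space_PiM)

lemma prob_space_path_measure: "prob_space (path_measure G \<pi>1 \<pi>2 v)"
proof -
  interpret IT: Ionescu_Tulcea "path_kernel G \<pi>1 \<pi>2 v" "\<lambda>_. count_space UNIV"
    by (rule Ionescu_Tulcea_path_kernel)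
  show ?thesis unfolding path_measure_def by (rule IT.prob_space_lim)
qed

text \<open>A finite product of finite discrete spaces is discrete, so every function of a prefix is
  measurable.\<close>

lemma borel_measurable_PiM_count_space:
  fixes f :: "(nat \<Rightarrow> 'v::finite) \<Rightarrow> ennreal"
  shows "f \<in> borel_measurable (PiM {0..<n} (\<lambda>_. count_space UNIV))"
proof -
  have "PiM {0..<n} (\<lambda>_. count_space (UNIV :: 'v set)) = count_space (PiE {0..<n} (\<lambda>_. UNIV))"
    by (rule count_space_PiM_finite) auto
  then show ?thesis by simp
qed

lemma map_restrict_upt: "\<forall>i<n. i \<in> A \<Longrightarrow> map (restrict \<omega> A) [0..<n] = map \<omega> [0..<n]"
  by simp

lemma map_upd_upt: "n \<le> m \<Longrightarrow> map (fun_upd \<omega> m x) [0..<n] = map \<omega> [0..<n]"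
  by simp

lemma borel_measurable_history:
  fixes F :: "'v::finite list \<Rightarrow> 'v \<Rightarrow> ennreal"
  shows "(\<lambda>\<omega>. F (map \<omega> [0..<n]) (\<omega> n)) \<in> borel_measurable (path_measure G \<pi>1 \<pi>2 v)"
proof -
  have "(\<lambda>\<omega>. restrict \<omega> {0..<Suc n}) \<in> measurable (path_measure G \<pi>1 \<pi>2 v)
      (PiM {0..<Suc n} (\<lambda>_. count_space UNIV))"
    by (simp add: measurable_cong_sets[OF sets_path_measure refl] measurable_restrict_subset)
  from measurable_compose[OF this borel_measurable_PiM_count_space[of "\<lambda>\<omega>. F (map \<omega> [0..<n]) (\<omega> n)"]]
  show ?thesis by (simp add: map_restrict_upt del: restrict_apply) simp
qed

lemma nn_integral_path_step:
  fixes G :: "'v::finite game"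
  shows "(\<integral>\<^sup>+\<omega>. F (map \<omega> [0..<n]) (\<omega> n) (\<omega> (Suc n)) \<partial>path_measure G \<pi>1 \<pi>2 v) =
    (\<integral>\<^sup>+\<omega>. (\<integral>\<^sup>+x. F (map \<omega> [0..<n]) (\<omega> n) x \<partial>next_vertex G \<pi>1 \<pi>2 (map \<omega> [0..<n]) (\<omega> n))
      \<partial>path_measure G \<pi>1 \<pi>2 v)"
proof -
  interpret IT: Ionescu_Tulcea "path_kernel G \<pi>1 \<pi>2 v" "\<lambda>_. count_space UNIV"
    by (rule Ionescu_Tulcea_path_kernel)
  show ?thesis
    \<comment> \<open>The vertex at \<open>Suc n\<close> is drawn by the kernel with index
      \<open>Suc n\<close>, whose history stops before \<open>n\<close> and whose current vertex is
      the one at \<open>n\<close>.\<close>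
    using IT.nn_integral_lim_step[of "\<lambda>\<omega>. F (map \<omega> [0..<n]) (\<omega> n) (\<omega> (Suc n))" "Suc n",
        OF borel_measurable_PiM_count_space]
    unfolding path_measure_def by (simp add: path_kernel_def map_restrict_upt map_upd_upt del: restrict_apply) simp
qed

lemma nn_integral_path_start:
  fixes G :: "'v::finite game"
  shows "(\<integral>\<^sup>+\<omega>. f (\<omega> 0) \<partial>path_measure G \<pi>1 \<pi>2 v) = f v"
proof -
  interpret IT: Ionescu_Tulcea "path_kernel G \<pi>1 \<pi>2 v" "\<lambda>_. count_space UNIV"
    by (rule Ionescu_Tulcea_path_kernel)
  interpret prob_space IT.PF.lim by (rule IT.prob_space_lim)
  show ?thesis
    using IT.nn_integral_lim_step[of "\<lambda>\<omega>. f (\<omega> 0)" 0, OF borel_measurable_PiM_count_space]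
    unfolding path_measure_def
    by (simp add: path_kernel_def emeasure_space_1[simplified])
qed

lemma AE_path_start:
  "AE \<omega> in path_measure G \<pi>1 \<pi>2 v. \<omega> 0 = v"
proof -
  have "(\<integral>\<^sup>+\<omega>. indicator (- {v}) (\<omega> 0) \<partial>path_measure G \<pi>1 \<pi>2 v) = 0"
    by (subst nn_integral_path_start) simp
  then show ?thesis
    by (subst (asm) nn_integral_0_iff_AE) (auto simp: indicator_def split: if_splits)
qed

text \<open>At each time the one-step integral of the indicator of a forbidden move is 0, and there
  are only countably many times. This permits arguments about individual plays consistent with the
  strategies.\<close>

lemma AE_path_step:
  "AE \<omega> in path_measure G \<pi>1 \<pi>2 v.
     \<forall>n. \<omega> (Suc n) \<in> set_pmf (next_vertex G \<pi>1 \<pi>2 (map \<omega> [0..<n]) (\<omega> n))"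
  unfolding AE_all_countable
proof
  fix n
  let ?F = "\<lambda>h u x. indicator (- set_pmf (next_vertex G \<pi>1 \<pi>2 h u)) x :: ennreal"
  have "(\<integral>\<^sup>+\<omega>. ?F (map \<omega> [0..<n]) (\<omega> n) (\<omega> (Suc n)) \<partial>path_measure G \<pi>1 \<pi>2 v) = 0"
  proof (subst nn_integral_path_step)
    have "(\<integral>\<^sup>+x. ?F h u x \<partial>next_vertex G \<pi>1 \<pi>2 h u) = 0" for h u
      by (subst nn_integral_0_iff_AE) (auto simp: AE_measure_pmf_iff)
    then show "(\<integral>\<^sup>+\<omega>. (\<integral>\<^sup>+x. ?F (map \<omega> [0..<n]) (\<omega> n) x
      \<partial>next_vertex G \<pi>1 \<pi>2 (map \<omega> [0..<n]) (\<omega> n)) \<partial>path_measure G \<pi>1 \<pi>2 v) = 0" by simp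
  qed
  moreover have "(\<lambda>\<omega>. ?F (map \<omega> [0..<n]) (\<omega> n) (\<omega> (Suc n))) \<in> borel_measurable (path_measure G \<pi>1 \<pi>2 v)"
    \<comment> \<open>The integrand uses two vertices beyond the history, so the one at
      \<open>n\<close> is stored as the last entry of a longer history.\<close>
    using borel_measurable_history[of "\<lambda>h. ?F (butlast h) (last h)" "Suc n"] by simp
  ultimately show "AE \<omega> in path_measure G \<pi>1 \<pi>2 v.
      \<omega> (Suc n) \<in> set_pmf (next_vertex G \<pi>1 \<pi>2 (map \<omega> [0..<n]) (\<omega> n))"
    by (subst (asm) nn_integral_0_iff_AE) (auto simp: indicator_def split: if_splits)
qed

section \<open>Telescoping bounds for the expected total cost\<close>

lemma nn_integral_supermartingale:
  fixes c g :: "'v::finite \<Rightarrow> ennreal"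
  assumes "\<And>h u. c u + (\<integral>\<^sup>+x. g x \<partial>next_vertex G \<pi>1 \<pi>2 h u) \<le> g u"
  shows "(\<integral>\<^sup>+\<omega>. (\<Sum>i. c (\<omega> i)) \<partial>path_measure G \<pi>1 \<pi>2 v) \<le> g v"
proof -
  let ?M = "path_measure G \<pi>1 \<pi>2 v"
  have step: "(\<integral>\<^sup>+\<omega>. c (\<omega> n) \<partial>?M) + (\<integral>\<^sup>+\<omega>. g (\<omega> (Suc n)) \<partial>?M) \<le> (\<integral>\<^sup>+\<omega>. g (\<omega> n) \<partial>?M)" for n
  proof -
    have "(\<integral>\<^sup>+\<omega>. c (\<omega> n) \<partial>?M) + (\<integral>\<^sup>+\<omega>. g (\<omega> (Suc n)) \<partial>?M) =
      (\<integral>\<^sup>+\<omega>. c (\<omega> n) + (\<integral>\<^sup>+x. g x \<partial>next_vertex G \<pi>1 \<pi>2 (map \<omega> [0..<n]) (\<omega> n)) \<partial>?M)"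
      using nn_integral_path_step[where F="\<lambda>_ _. g" and n=n]
        borel_measurable_history[of "\<lambda>h u. \<integral>\<^sup>+x. g x \<partial>next_vertex G \<pi>1 \<pi>2 h u" n G \<pi>1 \<pi>2 v]
      by (simp add: nn_integral_add)
    also have "\<dots> \<le> (\<integral>\<^sup>+\<omega>. g (\<omega> n) \<partial>?M)"
      by (intro nn_integral_mono assms)
    finally show ?thesis .
  qed
  \<comment> \<open>The remaining potential stays on the left, so the telescoping avoids subtraction
    in \<open>ennreal\<close>; it is dropped only afterwards.\<close>
  have sum: "(\<Sum>i<n. \<integral>\<^sup>+\<omega>. c (\<omega> i) \<partial>?M) + (\<integral>\<^sup>+\<omega>. g (\<omega> n) \<partial>?M) \<le> g v" for n
  proof (induction n)
    case (Suc n)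
    have "(\<Sum>i<Suc n. \<integral>\<^sup>+\<omega>. c (\<omega> i) \<partial>?M) + (\<integral>\<^sup>+\<omega>. g (\<omega> (Suc n)) \<partial>?M) \<le>
      (\<Sum>i<n. \<integral>\<^sup>+\<omega>. c (\<omega> i) \<partial>?M) + (\<integral>\<^sup>+\<omega>. g (\<omega> n) \<partial>?M)"
      using step[of n] by (simp add: add.assoc add_left_mono)
    with Suc show ?case by (rule order_trans[rotated])
  qed (simp add: nn_integral_path_start)
  have "(\<Sum>i<n. \<integral>\<^sup>+\<omega>. c (\<omega> i) \<partial>?M) \<le> g v" for n
    using order_trans[OF add_increasing2[OF zero_le order_refl] sum[of n]] .
  then have "(\<Sum>i. \<integral>\<^sup>+\<omega>. c (\<omega> i) \<partial>?M) \<le> g v"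
    by (intro suminf_le_const) auto
  then show ?thesis
    by (simp add: nn_integral_suminf)
qed

text \<open>The same telescoping with reversed inequalities. The remaining term cannot be dropped
  here; it tends to 0 by dominated convergence, with the finite maximum of \<open>f\<close> as
  dominating constant.\<close>

lemma nn_integral_submartingale:
  fixes c f :: "'v::finite \<Rightarrow> ennreal"
  assumes step: "\<And>h u. f u \<le> c u + (\<integral>\<^sup>+x. f x \<partial>next_vertex G \<pi>1 \<pi>2 h u)"
    and fin: "\<And>u. f u < \<infinity>"
    and vanish: "AE \<omega> in path_measure G \<pi>1 \<pi>2 v. \<forall>\<^sub>F n in sequentially. f (\<omega> n) = 0"
  shows "f v \<le> (\<integral>\<^sup>+\<omega>. (\<Sum>i. c (\<omega> i)) \<partial>path_measure G \<pi>1 \<pi>2 v)"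
proof -
  let ?M = "path_measure G \<pi>1 \<pi>2 v"
  interpret prob_space ?M by (rule prob_space_path_measure)
  have step': "(\<integral>\<^sup>+\<omega>. f (\<omega> n) \<partial>?M) \<le> (\<integral>\<^sup>+\<omega>. c (\<omega> n) \<partial>?M) + (\<integral>\<^sup>+\<omega>. f (\<omega> (Suc n)) \<partial>?M)" for n
  proof -
    have "(\<integral>\<^sup>+\<omega>. f (\<omega> n) \<partial>?M) \<le>
      (\<integral>\<^sup>+\<omega>. c (\<omega> n) + (\<integral>\<^sup>+x. f x \<partial>next_vertex G \<pi>1 \<pi>2 (map \<omega> [0..<n]) (\<omega> n)) \<partial>?M)"
      by (intro nn_integral_mono step)
    also have "\<dots> = (\<integral>\<^sup>+\<omega>. c (\<omega> n) \<partial>?M) + (\<integral>\<^sup>+\<omega>. f (\<omega> (Suc n)) \<partial>?M)"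
      using nn_integral_path_step[where F="\<lambda>_ _. f" and n=n]
        borel_measurable_history[of "\<lambda>h u. \<integral>\<^sup>+x. f x \<partial>next_vertex G \<pi>1 \<pi>2 h u" n G \<pi>1 \<pi>2 v]
      by (simp add: nn_integral_add)
    finally show ?thesis .
  qed
  have sum: "f v \<le> (\<Sum>i<n. \<integral>\<^sup>+\<omega>. c (\<omega> i) \<partial>?M) + (\<integral>\<^sup>+\<omega>. f (\<omega> n) \<partial>?M)" for n
  proof (induction n)
    case (Suc n)
    have "(\<Sum>i<n. \<integral>\<^sup>+\<omega>. c (\<omega> i) \<partial>?M) + (\<integral>\<^sup>+\<omega>. f (\<omega> n) \<partial>?M) \<le>
      (\<Sum>i<Suc n. \<integral>\<^sup>+\<omega>. c (\<omega> i) \<partial>?M) + (\<integral>\<^sup>+\<omega>. f (\<omega> (Suc n)) \<partial>?M)"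
      using step'[of n] by (simp add: add.assoc add_left_mono)
    with Suc show ?case by (rule order_trans)
  qed (simp add: nn_integral_path_start)
  have "(\<lambda>n. \<integral>\<^sup>+\<omega>. f (\<omega> n) \<partial>?M) \<longlonglongrightarrow> (\<integral>\<^sup>+\<omega>. 0 \<partial>?M)"
  proof (rule nn_integral_dominated_convergence)
    show "(\<integral>\<^sup>+\<omega>. Max (range f) \<partial>?M) < \<infinity>"
      using fin by (simp add: emeasure_space_1[simplified])
    show "AE \<omega> in ?M. (\<lambda>n. f (\<omega> n)) \<longlonglongrightarrow> 0"
      using vanish by eventually_elim (rule tendsto_eventually)
  qed (auto simp: Max_ge_iff)
  moreover have "(\<lambda>n. \<Sum>i<n. \<integral>\<^sup>+\<omega>. c (\<omega> i) \<partial>?M) \<longlonglongrightarrow> (\<Sum>i. \<integral>\<^sup>+\<omega>. c (\<omega> i) \<partial>?M)"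
    by (intro summable_LIMSEQ) simp
  ultimately have "(\<lambda>n. (\<Sum>i<n. \<integral>\<^sup>+\<omega>. c (\<omega> i) \<partial>?M) + (\<integral>\<^sup>+\<omega>. f (\<omega> n) \<partial>?M))
      \<longlonglongrightarrow> (\<Sum>i. \<integral>\<^sup>+\<omega>. c (\<omega> i) \<partial>?M) + 0"
    by (intro tendsto_add) simp_all
  then have "f v \<le> (\<Sum>i. \<integral>\<^sup>+\<omega>. c (\<omega> i) \<partial>?M) + 0"
    by (rule LIMSEQ_le_const) (use sum in auto)
  then show ?thesis
    by (simp add: nn_integral_suminf)
qed


section \<open>Stochastic games and the functional \<open>\<Gamma>\<close>\<close>

locale game =
  fixes G :: "'v::finite game"
  assumes stochastic_game: "stochastic_game G"
begin

lemma post_nonempty: "post G u \<noteq> {}"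
  using stochastic_game by (simp add: stochastic_game_def)

lemma delta_nonneg: "0 \<le> delta G u x"
  using stochastic_game by (simp add: stochastic_game_def)

lemma sum_delta: "u \<in> VP G \<Longrightarrow> (\<Sum>x\<in>UNIV. delta G u x) = 1"
  using stochastic_game by (simp add: stochastic_game_def)

lemma sum_post: "(\<Sum>x\<in>post G u. delta G u x * f x) = (\<Sum>x\<in>UNIV. delta G u x * f x)"
  using delta_nonneg[of u] by (intro sum.mono_neutral_left) (auto simp: post_def not_less intro: antisym)

lemma vertex_cases:
  obtains "u \<in> VP G" "u \<notin> V1 G" "u \<notin> V2 G" | "u \<in> V1 G" "u \<notin> VP G" "u \<notin> V2 G"
    | "u \<in> V2 G" "u \<notin> V1 G" "u \<notin> VP G"
  using stochastic_game by (auto simp: stochastic_game_def)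

lemma post_terminal: "t \<in> terminal G \<Longrightarrow> post G t = {t}"
  by (auto simp: terminal_def post_def)

lemma pmf_delta: "u \<in> VP G \<Longrightarrow> pmf (embed_pmf (delta G u)) x = delta G u x"
  using sum_delta[of u] delta_nonneg
  by (intro pmf_embed_pmf) (auto simp: nn_integral_count_space_finite sum_ennreal)

lemma set_pmf_delta: "u \<in> VP G \<Longrightarrow> set_pmf (embed_pmf (delta G u)) = post G u"
  using delta_nonneg by (auto simp: set_pmf_eq pmf_delta post_def order_less_le)

lemma nn_integral_delta:
  assumes "u \<in> VP G" "\<And>x. 0 \<le> f x"
  shows "(\<integral>\<^sup>+x. ennreal (f x) \<partial>embed_pmf (delta G u)) = ennreal (\<Sum>x\<in>post G u. delta G u x * f x)"
proof -
  have "(\<integral>\<^sup>+x. ennreal (f x) \<partial>embed_pmf (delta G u)) = (\<Sum>x\<in>post G u. ennreal (delta G u x * f x))"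
    using assms delta_nonneg
    by (subst nn_integral_measure_pmf_finite)
      (auto simp: set_pmf_delta pmf_delta ennreal_mult mult.commute)
  then show ?thesis using assms delta_nonneg by (simp add: sum_ennreal)
qed

lemma set_pmf_next_vertex:
  assumes "\<pi>1 \<in> strategies1 G" "\<pi>2 \<in> strategies2 G"
  shows "set_pmf (next_vertex G \<pi>1 \<pi>2 h u) \<subseteq> post G u"
  using assms by (cases u rule: vertex_cases)
    (auto simp: next_vertex_def strategies1_def strategies2_def strategies_def set_pmf_delta)

lemma \<Gamma>_terminal: "u \<in> terminal G \<Longrightarrow> \<Gamma> G r f u = 0"
  by (simp add: \<Gamma>_def)

lemma \<Gamma>_P: "u \<notin> terminal G \<Longrightarrow> u \<in> VP G \<Longrightarrow> \<Gamma> G r f u = r u + (\<Sum>x\<in>UNIV. delta G u x * f x)"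
  by (simp add: \<Gamma>_def sum_post)

lemma \<Gamma>_1: "u \<notin> terminal G \<Longrightarrow> u \<in> V1 G \<Longrightarrow> \<Gamma> G r f u = r u + Max (f ` post G u)"
proof -
  have "{r u + f x |x. x \<in> post G u} = (\<lambda>y. r u + y) ` f ` post G u" by auto
  moreover have "Max ((\<lambda>y. r u + y) ` f ` post G u) = r u + Max (f ` post G u)"
    using post_nonempty by (intro mono_Max_commute[symmetric]) (auto simp: mono_def)
  ultimately show "u \<notin> terminal G \<Longrightarrow> u \<in> V1 G \<Longrightarrow> \<Gamma> G r f u = r u + Max (f ` post G u)"
    by (cases u rule: vertex_cases) (simp_all add: \<Gamma>_def)
qed

lemma \<Gamma>_2: "u \<notin> terminal G \<Longrightarrow> u \<in> V2 G \<Longrightarrow> \<Gamma> G r f u = r u + Min (f ` post G u)"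
proof -
  have "{r u + f x |x. x \<in> post G u} = (\<lambda>y. r u + y) ` f ` post G u" by auto
  moreover have "Min ((\<lambda>y. r u + y) ` f ` post G u) = r u + Min (f ` post G u)"
    using post_nonempty by (intro mono_Min_commute[symmetric]) (auto simp: mono_def)
  ultimately show "u \<notin> terminal G \<Longrightarrow> u \<in> V2 G \<Longrightarrow> \<Gamma> G r f u = r u + Min (f ` post G u)"
    by (cases u rule: vertex_cases) (simp_all add: \<Gamma>_def)
qed

text \<open>Transition probabilities sum to 1, and maxima and minima commute with adding a constant.
  The case \<open>c = 0\<close> is monotonicity; positive \<open>c\<close> controls approximation
  errors of the game value.\<close>

lemma \<Gamma>_shift:
  assumes "\<And>x. f x \<le> g x + c" "0 \<le> c"
  shows "\<Gamma> G r f u \<le> \<Gamma> G r g u + c"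
proof (cases "u \<in> terminal G")
  case False
  show ?thesis
  proof (cases u rule: vertex_cases)
    case 1
    have "(\<Sum>x\<in>UNIV. delta G u x * f x) \<le> (\<Sum>x\<in>UNIV. delta G u x * (g x + c))"
      by (intro sum_mono mult_left_mono assms delta_nonneg)
    also have "\<dots> = (\<Sum>x\<in>UNIV. delta G u x * g x) + c"
      using sum_delta[OF 1(1)] by (simp add: distrib_left sum.distrib flip: sum_distrib_right)
    finally show ?thesis using False 1 by (simp add: \<Gamma>_P)
  next
    case 2
    have "f x \<le> Max (g ` post G u) + c" if "x \<in> post G u" for x
      using assms(1)[of x] Max_ge[of "g ` post G u" "g x"] that by (simp del: Max_ge)
    then show ?thesis using False 2 post_nonempty by (simp add: \<Gamma>_1)
  next
    case 3
    have "Min (f ` post G u) - c \<le> g x" if "x \<in> post G u" for x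
      using assms(1)[of x] Min_le[of "f ` post G u" "f x"] that by (simp del: Min_le)
    then have "Min (f ` post G u) - c \<le> Min (g ` post G u)"
      using post_nonempty by simp
    then show ?thesis using False 3 by (simp add: \<Gamma>_2)
  qed
qed (simp add: \<Gamma>_terminal assms)

lemma \<Gamma>_mono: "(\<And>x. f x \<le> g x) \<Longrightarrow> \<Gamma> G r f u \<le> \<Gamma> G r g u"
  using \<Gamma>_shift[of f g 0] by simp

lemma \<Gamma>_leI:
  assumes "u \<notin> terminal G"
    and "u \<in> VP G \<Longrightarrow> r u + (\<Sum>x\<in>UNIV. delta G u x * f x) \<le> b"
    and "\<And>x. u \<in> V1 G \<Longrightarrow> x \<in> post G u \<Longrightarrow> r u + f x \<le> b"
    and "u \<in> V2 G \<Longrightarrow> \<exists>x\<in>post G u. r u + f x \<le> b"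
  shows "\<Gamma> G r f u \<le> b"
proof (cases u rule: vertex_cases)
  case 1 then show ?thesis using assms by (simp add: \<Gamma>_P)
next
  case 2
  then have "Max (f ` post G u) \<le> b - r u"
    using assms(3) post_nonempty by (subst Max_le_iff) (auto simp: algebra_simps)
  with 2 show ?thesis using assms(1) by (simp add: \<Gamma>_1)
next
  case 3
  then have "Min (f ` post G u) \<le> b - r u"
    using assms(4) post_nonempty by (subst Min_le_iff) (auto simp: algebra_simps)
  with 3 show ?thesis using assms(1) by (simp add: \<Gamma>_2)
qed

section \<open>Measurability of fair plays and absorption in terminal vertices\<close>

lemma sets_paths[measurable]: "paths G \<in> sets (PiM UNIV (\<lambda>_. count_space UNIV))"
proof -
  have "{\<omega> \<in> space (PiM UNIV (\<lambda>_::nat. count_space (UNIV::'v set))).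
      \<forall>k. \<omega> (Suc k) \<in> post G (\<omega> k)} \<in> sets (PiM UNIV (\<lambda>_. count_space UNIV))"
    by measurable
  then show ?thesis by (simp add: paths_def post_def space_PiM)
qed

lemma sets_fair_plays[measurable]: "fair_plays G \<in> sets (PiM UNIV (\<lambda>_. count_space UNIV))"
proof -
  have "{\<omega> \<in> space (PiM UNIV (\<lambda>_::nat. count_space (UNIV::'v set))).
      \<omega> \<in> paths G \<and> (\<forall>v\<in>V2 G. (\<forall>m. \<exists>k>m. \<omega> k = v) \<longrightarrow> (\<forall>x\<in>post G v. \<forall>m. \<exists>k>m. \<omega> k = x))}
    \<in> sets (PiM UNIV (\<lambda>_. count_space UNIV))"
    by measurable
  then show ?thesis
    by (simp add: fair_plays_def inf_vertices_def space_PiM INFM_nat subset_eq)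
qed

lemma AE_paths:
  assumes "\<pi>1 \<in> strategies1 G" "\<pi>2 \<in> strategies2 G"
  shows "AE \<omega> in path_measure G \<pi>1 \<pi>2 v. \<omega> \<in> paths G"
  using AE_path_step
proof eventually_elim
  case (elim \<omega>)
  then show ?case
    using set_pmf_next_vertex[OF assms] by (fastforce simp: paths_def post_def)
qed

lemma path_absorbed:
  assumes "\<omega> \<in> paths G" "\<omega> i \<in> terminal G" "i \<le> j"
  shows "\<omega> j = \<omega> i"
  using assms(3)
proof (induction j rule: dec_induct)
  case (step j)
  have "\<omega> (Suc j) \<in> post G (\<omega> j)" using assms(1) by (simp add: paths_def post_def)
  with step post_terminal[OF assms(2)] show ?case by simp
qed simp

text \<open>After absorption only the terminal vertex recurs, and it is its own sole successor.
  Almost sure stopping is therefore a sufficient criterion for a strategy to be fair.\<close>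

lemma reach_terminal_fair:
  assumes "\<omega> \<in> reach_terminal G"
  shows "\<omega> \<in> fair_plays G"
proof -
  obtain i where i: "\<omega> \<in> paths G" "\<omega> i \<in> terminal G"
    using assms by (auto simp: reach_terminal_def)
  have "inf_vertices \<omega> = {\<omega> i}"
  proof -
    have "v = \<omega> i" if "v \<in> inf_vertices \<omega>" for v
    proof -
      have "\<exists>k>i. \<omega> k = v" using that by (simp add: inf_vertices_def INFM_nat)
      then obtain k where "k > i" "\<omega> k = v" by blast
      with path_absorbed[OF i, of k] show ?thesis by simp
    qed
    moreover have "\<omega> i \<in> inf_vertices \<omega>"
    proof -
      have "\<exists>k\<ge>m. \<omega> k = \<omega> i" for m
        using path_absorbed[OF i, of "max m i"] by (intro exI[of _ "max m i"]) simp
      then show ?thesis by (simp add: inf_vertices_def INFM_nat_le)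
    qed
    ultimately show ?thesis by blast
  qed
  then show ?thesis using i post_terminal[OF i(2)] by (simp add: fair_plays_def)
qed

lemma nn_integral_next_vertex_terminal:
  assumes "\<pi>1 \<in> strategies1 G" "\<pi>2 \<in> strategies2 G" "t \<in> terminal G"
  shows "(\<integral>\<^sup>+x. f x \<partial>next_vertex G \<pi>1 \<pi>2 h t) = f t"
proof -
  have "set_pmf (next_vertex G \<pi>1 \<pi>2 h t) = {t}"
    using set_pmf_next_vertex[OF assms(1,2), of h t] post_terminal[OF assms(3)] set_pmf_not_empty
    by (metis subset_singletonD)
  then have "next_vertex G \<pi>1 \<pi>2 h t = return_pmf t" by (simp flip: set_pmf_subset_singleton)
  then show ?thesis by simp
qed

section \<open>Positional greedy strategies\<close>

definition greedy1 :: "('v \<Rightarrow> real) \<Rightarrow> 'v strategy" where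
  "greedy1 f h u = return_pmf (SOME x. x \<in> post G u \<and> (\<forall>y\<in>post G u. f y \<le> f x))"

definition greedy2 :: "('v \<Rightarrow> real) \<Rightarrow> 'v strategy" where
  "greedy2 f h u = return_pmf (SOME x. x \<in> post G u \<and> (\<forall>y\<in>post G u. f x \<le> f y))"

lemma greedy1:
  obtains x where "greedy1 f h u = return_pmf x" "x \<in> post G u" "f x = Max (f ` post G u)"
proof -
  have "Max (f ` post G u) \<in> f ` post G u" using post_nonempty by (intro Max_in) auto
  then obtain x where "x \<in> post G u" "f x = Max (f ` post G u)" by auto
  then have "\<exists>x. x \<in> post G u \<and> (\<forall>y\<in>post G u. f y \<le> f x)" by auto
  from someI_ex[OF this] show thesis
    by (intro that) (auto simp: greedy1_def intro!: antisym Max.boundedI post_nonempty)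
qed

lemma greedy2:
  obtains x where "greedy2 f h u = return_pmf x" "x \<in> post G u" "f x = Min (f ` post G u)"
proof -
  have "Min (f ` post G u) \<in> f ` post G u" using post_nonempty by (intro Min_in) auto
  then obtain x where "x \<in> post G u" "f x = Min (f ` post G u)" by auto
  then have "\<exists>x. x \<in> post G u \<and> (\<forall>y\<in>post G u. f x \<le> f y)" by auto
  from someI_ex[OF this] show thesis
    by (intro that) (auto simp: greedy2_def intro!: antisym Min.boundedI post_nonempty)
qed

lemma greedy1_strategies1_DM: "greedy1 f \<in> strategies1_DM G"
proof -
  have "set_pmf (greedy1 f h u) \<subseteq> post G u" for h u by (rule greedy1[of f h u]) simp
  then show ?thesis
    by (auto simp: strategies1_DM_def strategies1_def strategies_def deterministic_def memoryless_def
        greedy1_def)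
qed

lemma greedy2_strategies2: "greedy2 f \<in> strategies2 G"
proof -
  have "set_pmf (greedy2 f h u) \<subseteq> post G u" for h u by (rule greedy2[of f h u]) simp
  then show ?thesis by (auto simp: strategies2_def strategies_def)
qed

text \<open>Player 2 attains the minimum in \<open>\<Gamma>\<close>, and whatever distribution
  Player 1 chooses, the average of \<open>g\<close> is at most its maximum over the
  successors.\<close>

lemma nn_integral_next_vertex_greedy2:
  assumes \<pi>1: "\<pi>1 \<in> strategies1 G" and u: "u \<notin> terminal G" and g: "\<And>x. 0 \<le> g x" and r: "0 \<le> r u"
  shows "ennreal (r u) + (\<integral>\<^sup>+x. ennreal (g x) \<partial>next_vertex G \<pi>1 (greedy2 g) h u) \<le> ennreal (\<Gamma> G r g u)"
proof (cases u rule: vertex_cases)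
  case 1
  have "0 \<le> (\<Sum>x\<in>UNIV. delta G u x * g x)"
    by (intro sum_nonneg mult_nonneg_nonneg delta_nonneg g)
  with 1 show ?thesis using u g r
    by (simp add: next_vertex_def nn_integral_delta \<Gamma>_P sum_post ennreal_plus)
next
  case 2
  have "(\<integral>\<^sup>+x. ennreal (g x) \<partial>\<pi>1 h u) \<le> (\<integral>\<^sup>+x. ennreal (Max (g ` post G u)) \<partial>\<pi>1 h u)"
    using 2 \<pi>1 by (intro nn_integral_mono_AE)
      (auto simp: AE_measure_pmf_iff strategies1_def strategies_def intro!: ennreal_leI Max_ge)
  moreover have "0 \<le> Max (g ` post G u)"
    using g post_nonempty by (auto simp: Max_ge_iff)
  ultimately show ?thesis using u r 2
    by (simp add: next_vertex_def \<Gamma>_1 ennreal_plus measure_pmf.emeasure_space_1[simplified] add_left_mono)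
next
  case 3
  obtain x where "greedy2 g h u = return_pmf x" "x \<in> post G u" "g x = Min (g ` post G u)"
    by (rule greedy2)
  with 3 show ?thesis using u r g[of x]
    by (simp add: next_vertex_def \<Gamma>_2 flip: ennreal_plus)
qed

text \<open>The dual bound: Player 1 attains the maximum in \<open>\<Gamma>\<close>, and any choice
  of Player 2 averages to at least the minimum.\<close>

lemma nn_integral_next_vertex_greedy1:
  assumes \<pi>2: "\<pi>2 \<in> strategies2 G" and u: "u \<notin> terminal G" and f: "\<And>x. 0 \<le> f x" and r: "0 \<le> r u"
  shows "ennreal (\<Gamma> G r f u) \<le> ennreal (r u) + (\<integral>\<^sup>+x. ennreal (f x) \<partial>next_vertex G (greedy1 f) \<pi>2 h u)"
proof (cases u rule: vertex_cases)
  case 1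
  have "0 \<le> (\<Sum>x\<in>UNIV. delta G u x * f x)"
    by (intro sum_nonneg mult_nonneg_nonneg delta_nonneg f)
  with 1 show ?thesis using u f r
    by (simp add: next_vertex_def nn_integral_delta \<Gamma>_P sum_post ennreal_plus)
next
  case 2
  obtain x where "greedy1 f h u = return_pmf x" "x \<in> post G u" "f x = Max (f ` post G u)"
    by (rule greedy1)
  with 2 show ?thesis using u r f[of x]
    by (simp add: next_vertex_def \<Gamma>_1 flip: ennreal_plus)
next
  case 3
  have "(\<integral>\<^sup>+x. ennreal (Min (f ` post G u)) \<partial>\<pi>2 h u) \<le> (\<integral>\<^sup>+x. ennreal (f x) \<partial>\<pi>2 h u)"
    using 3 \<pi>2 by (intro nn_integral_mono_AE)
      (auto simp: AE_measure_pmf_iff strategies2_def strategies_def intro!: ennreal_leI Min_le)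
  moreover have "0 \<le> Min (f ` post G u)"
    using f post_nonempty by (auto simp: Min_ge_iff)
  ultimately show ?thesis using u r 3
    by (simp add: next_vertex_def \<Gamma>_2 ennreal_plus measure_pmf.emeasure_space_1[simplified] add_left_mono)
qed


section \<open>Existence of fair strategies\<close>

text \<open>
  All plays consistent with this strategy are fair, so that no Borel-Cantelli argument is needed
  to see that fair strategies exist.
\<close>

definition post_list :: "'v \<Rightarrow> 'v list" where
  "post_list u = (SOME xs. set xs = post G u)"

definition round_robin :: "'v strategy" where
  "round_robin h u = return_pmf (post_list u ! (count_list h u mod length (post_list u)))"

lemma set_post_list[simp]: "set (post_list u) = post G u"
  unfolding post_list_def using finite_list[of "post G u", OF finite] by (rule someI_ex)

lemma length_post_list: "0 < length (post_list u)"
  using post_nonempty[of u] set_post_list[of u] by fastforce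

lemma round_robin_strategies2: "round_robin \<in> strategies2 G"
proof -
  have "post_list u ! (count_list h u mod length (post_list u)) \<in> set (post_list u)" for h u
    by (intro nth_mem mod_less_divisor length_post_list)
  then show ?thesis
    by (simp add: strategies2_def strategies_def round_robin_def)
qed

text \<open>The number of earlier visits to \<open>u\<close> grows by exactly one from each visit to
  the next, so on a play visiting \<open>u\<close> infinitely often it takes every value
  \<open>m\<close>.\<close>

lemma ex_visit_with_count:
  assumes "\<exists>\<^sub>\<infinity>k. \<omega> k = u"
  shows "\<exists>k. \<omega> k = u \<and> count_list (map \<omega> [0..<k]) u = m"
proof -
  have next_visit: "\<exists>k. \<omega> k = u \<and> count_list (map \<omega> [0..<k]) u = count_list (map \<omega> [0..<k0]) u" for k0
  proof -
    define k where "k = (LEAST k. k0 \<le> k \<and> \<omega> k = u)"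
    have "\<exists>k\<ge>k0. \<omega> k = u" using assms by (simp add: INFM_nat_le)
    then have k: "k0 \<le> k" "\<omega> k = u" unfolding k_def by (smt (verit) LeastI_ex)+
    have not_u: "\<omega> j \<noteq> u" if "k0 \<le> j" "j < k" for j
      using not_less_Least[of j "\<lambda>k. k0 \<le> k \<and> \<omega> k = u"] that by (auto simp: k_def)
    have "count_list (map \<omega> [0..<j]) u = count_list (map \<omega> [0..<k0]) u"
      if "k0 \<le> j" "j \<le> k" for j
      using that by (induction j rule: dec_induct) (auto simp: not_u)
    with k show ?thesis by blast
  qed
  show ?thesis
  proof (induction m)
    case 0
    show ?case using next_visit[of 0] by simp
  next
    case (Suc m)
    then obtain k where "\<omega> k = u" "count_list (map \<omega> [0..<k]) u = m" by blast
    then show ?case using next_visit[of "Suc k"] by simp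
  qed
qed

lemma count_list_map_upt_le: "count_list (map \<omega> [0..<k]) u \<le> k"
  using count_le_length[of "map \<omega> [0..<k]" u] by simp

lemma round_robin_fair: "round_robin \<in> strategies2_F G"
proof -
  have "measure (path_measure G \<pi>1 round_robin v) (fair_plays G) = 1"
    if \<pi>1: "\<pi>1 \<in> strategies1 G" for \<pi>1 v
  proof -
    interpret prob_space "path_measure G \<pi>1 round_robin v" by (rule prob_space_path_measure)
    have "AE \<omega> in path_measure G \<pi>1 round_robin v. \<omega> \<in> fair_plays G"
      using AE_path_step AE_paths[OF \<pi>1 round_robin_strategies2]
    proof eventually_elim
      case (elim \<omega>)
      have "x \<in> inf_vertices \<omega>"
        if u: "u \<in> V2 G" "u \<in> inf_vertices \<omega>" and x: "x \<in> post G u" for u x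
        unfolding inf_vertices_def INFM_nat_le mem_Collect_eq
      proof
        fix m
        let ?l = "length (post_list u)"
        obtain j where j: "j < ?l" "post_list u ! j = x"
          using x by (metis in_set_conv_nth set_post_list)
        \<comment> \<open>This count is \<open>j\<close> modulo \<open>?l\<close>, so
          \<open>x\<close> is chosen next; it is also at least \<open>m\<close>, and a prefix with
          that many visits has length at least \<open>m\<close>.\<close>
        obtain k where k: "\<omega> k = u" "count_list (map \<omega> [0..<k]) u = j + m * ?l"
          using ex_visit_with_count[of \<omega> u "j + m * ?l"] u(2) by (auto simp: inf_vertices_def)
        have "m * 1 \<le> m * ?l" using length_post_list[of u] by (intro mult_le_mono2) linarith
        with k(2) count_list_map_upt_le[of \<omega> k u] have "m \<le> k" by linarith
        moreover have "u \<notin> V1 G" using u(1) by (cases u rule: vertex_cases) auto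
        then have "\<omega> (Suc k) = x"
          using elim(1)[rule_format, of k] k j u(1) by (simp add: next_vertex_def round_robin_def)
        ultimately show "\<exists>k\<ge>m. \<omega> k = x" by (intro exI[of _ "Suc k"]) simp
      qed
      with elim(2) show ?case by (auto simp: fair_plays_def)
    qed
    then show ?thesis by (subst (asm) AE_in_set_eq_1) (simp_all add: sets_path_measure sets_fair_plays)
  qed
  with round_robin_strategies2 show ?thesis by (simp add: strategies2_F_def)
qed

lemma strategies2_F_I:
  assumes \<pi>2: "\<pi>2 \<in> strategies2 G"
    and reach: "\<And>\<pi>1 u. \<pi>1 \<in> strategies1 G \<Longrightarrow> AE \<omega> in path_measure G \<pi>1 \<pi>2 u. \<exists>i. \<omega> i \<in> terminal G"
  shows "\<pi>2 \<in> strategies2_F G"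
proof -
  have "measure (path_measure G \<pi>1 \<pi>2 u) (fair_plays G) = 1" if \<pi>1: "\<pi>1 \<in> strategies1 G" for \<pi>1 u
  proof -
    interpret prob_space "path_measure G \<pi>1 \<pi>2 u" by (rule prob_space_path_measure)
    have "AE \<omega> in path_measure G \<pi>1 \<pi>2 u. \<omega> \<in> fair_plays G"
      using AE_paths[OF \<pi>1 \<pi>2] reach[OF \<pi>1]
      by eventually_elim (auto intro!: reach_terminal_fair simp: reach_terminal_def)
    then show ?thesis by (subst (asm) AE_in_set_eq_1) (simp_all add: sets_path_measure sets_fair_plays)
  qed
  with \<pi>2 show ?thesis by (simp add: strategies2_F_def)
qed

end

section \<open>A potential function from the stopping assumption\<close>

locale stopping_game = game G for G :: "'v::finite game" +
  assumes stopping: "stopping_under_fairness G"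
begin

lemma AE_reach_terminal:
  assumes "\<pi>1 \<in> strategies1 G" "\<pi>2 \<in> strategies2_F G"
  shows "AE \<omega> in path_measure G \<pi>1 \<pi>2 v. \<omega> \<in> reach_terminal G"
  using stopping assms by (intro prob_space.AE_prob_1 prob_space_path_measure)
    (simp add: stopping_under_fairness_def)

text \<open>Player 1 could keep the play in \<open>W\<close> forever, whatever Player 2 and chance
  do, in particular against the fair strategy \<open>round_robin\<close>. This contradicts stopping
  under fairness.\<close>

lemma no_trap:
  assumes W: "W \<noteq> {}" "W \<inter> terminal G = {}"
    and stay1: "\<And>u. u \<in> W \<Longrightarrow> u \<in> V1 G \<Longrightarrow> post G u \<inter> W \<noteq> {}"
    and stay: "\<And>u. u \<in> W \<Longrightarrow> u \<notin> V1 G \<Longrightarrow> post G u \<subseteq> W"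
  shows False
proof -
  obtain v where v: "v \<in> W" using W by blast
  \<comment> \<open>Maximising the indicator of \<open>W\<close> means moving into \<open>W\<close>
    whenever some successor lies there.\<close>
  let ?\<sigma> = "greedy1 (indicator W)"
  have \<sigma>: "?\<sigma> \<in> strategies1 G" using greedy1_strategies1_DM by (simp add: strategies1_DM_def)
  have next_in: "set_pmf (next_vertex G ?\<sigma> round_robin h u) \<subseteq> W" if u: "u \<in> W" for h u
  proof (cases "u \<in> V1 G")
    case True
    obtain x where x: "?\<sigma> h u = return_pmf x" "x \<in> post G u"
        "(indicator W x :: real) = Max (indicator W ` post G u)"
      by (rule greedy1)
    obtain y where "y \<in> post G u" "y \<in> W" using stay1[OF u True] by blast
    then have "(1::real) \<le> Max (indicator W ` post G u)"
      by (intro Max_ge image_eqI[of _ _ y]) auto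
    then have "x \<in> W" unfolding x(3)[symmetric] by (cases "x \<in> W") simp_all
    with True x(1) show ?thesis by (simp add: next_vertex_def)
  next
    case False
    then show ?thesis
      using set_pmf_next_vertex[OF \<sigma> round_robin_strategies2, of h u] stay[OF u] by blast
  qed
  interpret prob_space "path_measure G ?\<sigma> round_robin v" by (rule prob_space_path_measure)
  have "AE \<omega> in path_measure G ?\<sigma> round_robin v. False"
    using AE_path_start AE_path_step AE_reach_terminal[OF \<sigma> round_robin_fair]
  proof eventually_elim
    case (elim \<omega>)
    have "\<omega> n \<in> W" for n
    proof (induction n)
      case 0 then show ?case using elim(1) v by simp
    next
      case (Suc n) then show ?case using elim(2) next_in by blast
    qed
    with elim(3) W(2) show ?case by (auto simp: reach_terminal_def)
  qed
  then show False by simp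
qed

text \<open>
  Here Player 2 maximises \<open>d\<close> and Player 1 minimises it, the roles of \<open>\<Gamma>\<close> for \<open>- d\<close>. A maximal set on
  which such a \<open>d\<close> is positive and rises plays the part of Player 2's attractor to the terminal vertices.
\<close>

definition lifts :: "real \<Rightarrow> ('v \<Rightarrow> real) \<Rightarrow> 'v \<Rightarrow> bool" where
  "lifts b d u \<longleftrightarrow> (u \<in> VP G \<longrightarrow> b < (\<Sum>x\<in>UNIV. delta G u x * d x)) \<and>
     (u \<in> V1 G \<longrightarrow> (\<forall>x\<in>post G u. b < d x)) \<and> (u \<in> V2 G \<longrightarrow> (\<exists>x\<in>post G u. b < d x))"

lemma lifts_mono:
  assumes "lifts b d u" "b' \<le> b" "\<And>x. d x \<le> d' x"
  shows "lifts b' d' u"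
proof -
  have "(\<Sum>x\<in>UNIV. delta G u x * d x) \<le> (\<Sum>x\<in>UNIV. delta G u x * d' x)"
    by (intro sum_mono mult_left_mono assms delta_nonneg)
  with assms show ?thesis unfolding lifts_def by (meson order.strict_trans1 order.strict_trans2)
qed

text \<open>Only finitely many successors are involved, so strict inequalities leave a positive gap.
  This gap provides both new potential values and the margin of a strictly superharmonic
  function.\<close>

lemma lifts_slack:
  assumes "lifts b d u"
  shows "\<exists>m>0. lifts (b + m) d u"
proof (cases u rule: vertex_cases)
  case 1
  with assms show ?thesis
    by (intro exI[of _ "((\<Sum>x\<in>UNIV. delta G u x * d x) - b) / 2"]) (simp add: lifts_def field_simps)
next
  case 2
  define a where "a = Min (d ` post G u)"
  have a: "b < a"
    using assms 2 post_nonempty by (simp add: lifts_def a_def)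
  obtain c where c: "b < c" "c < a" using dense[OF a] by blast
  have "c < d x" if "x \<in> post G u" for x
  proof -
    have "a \<le> d x" unfolding a_def using that by (intro Min_le) auto
    with c show ?thesis by linarith
  qed
  with c 2 show ?thesis by (intro exI[of _ "c - b"]) (simp add: lifts_def)
next
  case 3
  then obtain x where "x \<in> post G u" "b < d x" using assms by (auto simp: lifts_def)
  moreover from this have "b + (d x - b) / 2 < d x" "0 < (d x - b) / 2" by (simp_all add: field_simps)
  ultimately show ?thesis using 3 unfolding lifts_def by blast
qed

lemma ex_potential: "\<exists>d. \<forall>u. u \<notin> terminal G \<longrightarrow> lifts (d u) d u"
proof -
  \<comment> \<open>Lifting is required only where \<open>d\<close> is positive. Among such
    functions one of maximal support is taken, and maximality forces lifting at every nonterminal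
    vertex.\<close>
  define good where "good d \<longleftrightarrow> (\<forall>u. 0 \<le> d u) \<and> (\<forall>u\<in>terminal G. 0 < d u) \<and>
    (\<forall>u. 0 < d u \<and> u \<notin> terminal G \<longrightarrow> lifts (d u) d u)" for d
  define supp where "supp d = {u. 0 < d u}" for d :: "'v \<Rightarrow> real"
  have "good (indicator (terminal G))"
    by (auto simp: good_def indicator_def)
  moreover have "\<forall>d. good d \<longrightarrow> card (supp d) < Suc CARD('v)"
    by (simp add: card_mono less_Suc_eq_le)
  ultimately have "\<exists>d. good d \<and> (\<forall>d'. good d' \<longrightarrow> card (supp d') \<le> card (supp d))"
    by (rule ex_has_greatest_nat)
  then obtain d where d: "good d" and max: "\<And>d'. good d' \<Longrightarrow> card (supp d') \<le> card (supp d)"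
    by blast
  have "lifts (d u) d u" if u: "u \<notin> terminal G" for u
  proof (cases "0 < d u")
    case False
    \<comment> \<open>If no zero of \<open>d\<close> lifted, Player 1 could remain among the zeros
      and neither Player 2 nor chance could leave them: a trap.\<close>
    have "\<exists>w. d w = 0 \<and> lifts 0 d w"
    proof (rule ccontr)
      assume no: "\<nexists>w. d w = 0 \<and> lifts 0 d w"
      have nonneg: "0 \<le> d x" for x using d by (simp add: good_def)
      have stay1: "post G w \<inter> {w. d w = 0} \<noteq> {}" if w: "d w = 0" "w \<in> V1 G" for w
      proof
        assume "post G w \<inter> {w. d w = 0} = {}"
        then have "0 < d x" if "x \<in> post G w" for x
          using that nonneg[of x] by (cases "d x = 0") auto
        moreover have "w \<notin> VP G" "w \<notin> V2 G" using w(2) by (cases w rule: vertex_cases; simp)+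
        ultimately have "lifts 0 d w" by (simp add: lifts_def)
        with no w(1) show False by blast
      qed
      have stay: "d x = 0" if w: "d w = 0" "w \<notin> V1 G" and x: "x \<in> post G w" for w x
      proof (rule ccontr)
        assume "d x \<noteq> 0"
        then have pos: "0 < d x" using nonneg[of x] by simp
        have "0 < (\<Sum>x\<in>UNIV. delta G w x * d x)"
          using x pos nonneg delta_nonneg
          by (intro sum_pos2[of _ x]) (auto simp: post_def)
        with x pos w(2) have "lifts 0 d w" unfolding lifts_def by blast
        with no w show False by blast
      qed
      show False
      proof (rule no_trap[of "{w. d w = 0}"])
        have "d u = 0" using False nonneg[of u] by simp
        then show "{w. d w = 0} \<noteq> {}" by blast
        show "{w. d w = 0} \<inter> terminal G = {}" using d by (auto simp: good_def)
      qed (use stay1 stay in blast)+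
    qed
    then obtain w where w: "d w = 0" "lifts 0 d w" by blast
    \<comment> \<open>The slack becomes the new value at \<open>w\<close>. Raising \<open>d\<close>
      there preserves lifting elsewhere and enlarges the support, contradicting maximality.\<close>
    from lifts_slack[OF w(2)] obtain m where m: "0 < m" "lifts m d w" by auto
    have le: "d x \<le> (d(w := m)) x" for x using w m by simp
    have "lifts ((d(w := m)) x) (d(w := m)) x" if x: "0 < (d(w := m)) x" "x \<notin> terminal G" for x
    proof (rule lifts_mono[OF _ order_refl le])
      show "lifts ((d(w := m)) x) d x" using d m x by (cases "x = w") (simp_all add: good_def)
    qed
    moreover have "0 \<le> (d(w := m)) x" for x using d m by (simp add: good_def)
    moreover have "0 < (d(w := m)) x" if "x \<in> terminal G" for x using d m that by (simp add: good_def)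
    ultimately have "good (d(w := m))" by (simp add: good_def del: fun_upd_apply)
    moreover have "supp (d(w := m)) = insert w (supp d)" "w \<notin> supp d"
      using w m by (auto simp: supp_def)
    ultimately show ?thesis using max[of "d(w := m)"] by simp
  qed (use d u in \<open>simp add: good_def\<close>)
  then show ?thesis by blast
qed

end

section \<open>Strictly superharmonic functions\<close>

locale reward_game = game G for G :: "'v::finite game" +
  fixes r :: "'v \<Rightarrow> real"
  assumes reward_function: "reward_function G r"
begin

lemma r_nonneg: "0 \<le> r u"
  using reward_function by (simp add: reward_function_def)

lemma r_terminal: "u \<in> terminal G \<Longrightarrow> r u = 0"
  using reward_function by (simp add: reward_function_def)

lemma \<Gamma>_nonneg:
  assumes "\<And>x. 0 \<le> f x"
  shows "0 \<le> \<Gamma> G r f u"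
proof (cases "u \<in> terminal G")
  case False
  have Max: "0 \<le> Max (f ` post G u)" and Min: "0 \<le> Min (f ` post G u)"
    using assms post_nonempty by (auto simp: Max_ge_iff)
  show ?thesis
    using False r_nonneg[of u] Max Min assms delta_nonneg
    by (cases u rule: vertex_cases) (auto simp: \<Gamma>_P \<Gamma>_1 \<Gamma>_2 intro!: add_nonneg_nonneg sum_nonneg)
qed (simp add: \<Gamma>_terminal)

text \<open>Without the margin, minimising play could circle forever along ties of \<open>g\<close>
  and fail to be fair.\<close>

definition strict_super :: "('v \<Rightarrow> real) set" where
  "strict_super = {g. (\<forall>u. 0 \<le> g u) \<and> (\<exists>\<epsilon>>0. \<forall>u. u \<notin> terminal G \<longrightarrow> \<Gamma> G r g u + \<epsilon> \<le> g u)}"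

lemma strict_superE:
  assumes "g \<in> strict_super"
  obtains \<epsilon> where "0 < \<epsilon>" "\<And>u. 0 \<le> g u" "\<And>u. u \<notin> terminal G \<Longrightarrow> \<Gamma> G r g u + \<epsilon> \<le> g u"
  using assms by (auto simp: strict_super_def)

lemma strict_super_\<Gamma>_le:
  assumes "g \<in> strict_super"
  shows "\<Gamma> G r g u \<le> g u"
proof -
  obtain \<epsilon> where "0 < \<epsilon>" "\<And>u. 0 \<le> g u" "\<And>u. u \<notin> terminal G \<Longrightarrow> \<Gamma> G r g u + \<epsilon> \<le> g u"
    using assms by (rule strict_superE) blast
  from this(1) this(2,3)[of u] show ?thesis by (cases "u \<in> terminal G") (auto simp: \<Gamma>_terminal)
qed

text \<open>
  The margin \<open>\<epsilon>\<close> bounds the expected time spent outside the terminal vertices by \<open>g v / \<epsilon>\<close>.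
\<close>

lemma greedy2_strict_super:
  assumes g: "g \<in> strict_super" and \<pi>1: "\<pi>1 \<in> strategies1 G"
  shows "expected_rew G r \<pi>1 (greedy2 g) v \<le> ennreal (g v)"
    and "AE \<omega> in path_measure G \<pi>1 (greedy2 g) v. \<exists>i. \<omega> i \<in> terminal G"
proof -
  let ?M = "path_measure G \<pi>1 (greedy2 g) v"
  obtain \<epsilon> where \<epsilon>: "0 < \<epsilon>" and nonneg: "\<And>u. 0 \<le> g u"
    and margin: "\<And>u. u \<notin> terminal G \<Longrightarrow> \<Gamma> G r g u + \<epsilon> \<le> g u"
    using g by (rule strict_superE) blast
  \<comment> \<open>The margin is charged as an extra cost off the terminal vertices, so a single
    supermartingale bound covers both the reward and the stopping time.\<close>
  define c where "c u = r u + (if u \<in> terminal G then 0 else \<epsilon>)" for u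
  have c_nonneg: "0 \<le> c u" for u using r_nonneg \<epsilon> by (simp add: c_def)
  have "ennreal (c u) + (\<integral>\<^sup>+x. ennreal (g x) \<partial>next_vertex G \<pi>1 (greedy2 g) h u) \<le> ennreal (g u)" for h u
  proof (cases "u \<in> terminal G")
    case True
    then show ?thesis
      by (simp add: c_def r_terminal nn_integral_next_vertex_terminal[OF \<pi>1 greedy2_strategies2])
  next
    case False
    have "ennreal (c u) + (\<integral>\<^sup>+x. ennreal (g x) \<partial>next_vertex G \<pi>1 (greedy2 g) h u) =
        ennreal \<epsilon> + (ennreal (r u) + (\<integral>\<^sup>+x. ennreal (g x) \<partial>next_vertex G \<pi>1 (greedy2 g) h u))"
      using False \<epsilon> r_nonneg[of u] by (simp add: c_def ac_simps)
    also have "\<dots> \<le> ennreal \<epsilon> + ennreal (\<Gamma> G r g u)"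
      by (intro add_left_mono nn_integral_next_vertex_greedy2 \<pi>1 False nonneg r_nonneg)
    also have "\<dots> = ennreal (\<Gamma> G r g u + \<epsilon>)"
      using \<epsilon> \<Gamma>_nonneg[OF nonneg] by (simp add: ac_simps)
    also have "\<dots> \<le> ennreal (g u)"
      by (intro ennreal_leI margin False)
    finally show ?thesis .
  qed
  then have le: "(\<integral>\<^sup>+\<omega>. (\<Sum>i. ennreal (c (\<omega> i))) \<partial>?M) \<le> ennreal (g v)"
    by (rule nn_integral_supermartingale)
  have "expected_rew G r \<pi>1 (greedy2 g) v \<le> (\<integral>\<^sup>+\<omega>. (\<Sum>i. ennreal (c (\<omega> i))) \<partial>?M)"
    unfolding expected_rew_def rew_def
    using \<epsilon> by (intro nn_integral_mono suminf_le ennreal_leI) (auto simp: c_def)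
  with le show "expected_rew G r \<pi>1 (greedy2 g) v \<le> ennreal (g v)" by (rule order_trans[rotated])
  have "AE \<omega> in ?M. (\<Sum>i. ennreal (c (\<omega> i))) \<noteq> \<infinity>"
    by (rule nn_integral_PInf_AE) (use le in \<open>auto simp: top_unique\<close>)
  then show "AE \<omega> in ?M. \<exists>i. \<omega> i \<in> terminal G"
  proof eventually_elim
    case (elim \<omega>)
    \<comment> \<open>A finite total cost forces the costs to tend to 0, whereas every nonterminal
      vertex costs at least \<open>\<epsilon>\<close>.\<close>
    then have "summable (\<lambda>i. c (\<omega> i))"
      by (intro summable_suminf_not_top c_nonneg) simp
    then have "(\<lambda>i. c (\<omega> i)) \<longlonglongrightarrow> 0" by (rule summable_LIMSEQ_zero)
    then have "\<forall>\<^sub>F i in sequentially. c (\<omega> i) < \<epsilon>" using \<epsilon> by (rule order_tendstoD)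
    then obtain i where "c (\<omega> i) < \<epsilon>" by (auto simp: eventually_sequentially)
    then show ?case using r_nonneg[of "\<omega> i"] by (auto simp: c_def split: if_splits)
  qed
qed

lemma greedy2_fair: "g \<in> strict_super \<Longrightarrow> greedy2 g \<in> strategies2_F G"
  by (intro strategies2_F_I greedy2_strategies2 greedy2_strict_super)

text \<open>By monotonicity \<open>\<Gamma>\<close> of the minimum lies below
  \<open>\<Gamma>\<close> of both functions, and the smaller margin works. Closure under minima
  makes the infimum approximable at all vertices simultaneously.\<close>

lemma strict_super_min:
  assumes f: "f \<in> strict_super" and g: "g \<in> strict_super"
  shows "(\<lambda>u. min (f u) (g u)) \<in> strict_super" (is "?m \<in> _")
proof -
  obtain \<epsilon> where \<epsilon>: "0 < \<epsilon>" "\<And>u. 0 \<le> f u" "\<And>u. u \<notin> terminal G \<Longrightarrow> \<Gamma> G r f u + \<epsilon> \<le> f u"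
    using f by (rule strict_superE) blast
  obtain \<epsilon>' where \<epsilon>': "0 < \<epsilon>'" "\<And>u. 0 \<le> g u" "\<And>u. u \<notin> terminal G \<Longrightarrow> \<Gamma> G r g u + \<epsilon>' \<le> g u"
    using g by (rule strict_superE) blast
  have "\<Gamma> G r ?m u + min \<epsilon> \<epsilon>' \<le> ?m u" if "u \<notin> terminal G" for u
  proof -
    have "\<Gamma> G r ?m u \<le> \<Gamma> G r f u" "\<Gamma> G r ?m u \<le> \<Gamma> G r g u" by (auto intro: \<Gamma>_mono)
    with \<epsilon>(3)[OF that] \<epsilon>'(3)[OF that] show ?thesis by linarith
  qed
  with \<epsilon>(1,2) \<epsilon>'(1,2) show ?thesis
    unfolding strict_super_def by (auto intro!: exI[of _ "min \<epsilon> \<epsilon>'"])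
qed

definition game_value :: "'v \<Rightarrow> real" where
  "game_value u = (INF g\<in>strict_super. g u)"

end

section \<open>The game value as a fixed point of \<open>\<Gamma>\<close>\<close>

locale stopping_reward_game = reward_game G r + stopping_game G
  for G :: "'v::finite game" and r
begin

text \<open>A potential \<open>d\<close> rising by more than \<open>m\<close> per step is turned
  upside down and scaled: \<open>K * (D - d u)\<close> then falls fast enough to pay any reward with
  1 to spare.\<close>

lemma strict_super_nonempty: "strict_super \<noteq> {}"
proof -
  obtain d where d: "\<And>u. u \<notin> terminal G \<Longrightarrow> lifts (d u) d u" using ex_potential by blast
  have "\<exists>m>0. u \<notin> terminal G \<longrightarrow> lifts (d u + m) d u" for u
    using lifts_slack[OF d] zero_less_one by blast
  then obtain s where s: "\<And>u. 0 < s u" "\<And>u. u \<notin> terminal G \<Longrightarrow> lifts (d u + s u) d u"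
    by metis
  define m where "m = Min (range s)"
  have m: "0 < m" unfolding m_def using s(1) by simp
  have lifts: "lifts (d u + m) d u" if "u \<notin> terminal G" for u
    by (rule lifts_mono[OF s(2)[OF that]]) (simp_all add: m_def)
  define D where "D = Max (range d)"
  have D: "d u \<le> D" for u by (simp add: D_def)
  \<comment> \<open>The drop \<open>K * m\<close> equals the largest reward plus the margin
    1.\<close>
  define K where "K = (Max (range r) + 1) / m"
  have "0 \<le> Max (range r)" using r_nonneg by (auto simp: Max_ge_iff)
  then have K: "0 < K" "K * m = Max (range r) + 1" using m by (simp_all add: K_def)
  define g where "g u = K * (D - d u)" for u
  have reward: "r u \<le> K * m - 1" for u unfolding K by simp
  \<comment> \<open>Here \<open>y\<close> stands for the potential after the step: the value at one
    successor, or the mean at a probabilistic vertex.\<close>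
  have less: "r u + K * (D - y) \<le> g u - 1" if "d u + m < y" for u y
  proof -
    have "K * (d u + m) \<le> K * y" using that K by (intro mult_left_mono) auto
    with reward[of u] show ?thesis by (simp add: g_def algebra_simps)
  qed
  have "\<Gamma> G r g u \<le> g u - 1" if u: "u \<notin> terminal G" for u
  proof (rule \<Gamma>_leI[OF u])
    assume P: "u \<in> VP G"
    have "(\<Sum>x\<in>UNIV. delta G u x * g x) = K * (D * (\<Sum>x\<in>UNIV. delta G u x) - (\<Sum>x\<in>UNIV. delta G u x * d x))"
      by (simp add: g_def algebra_simps sum_subtractf sum_distrib_left)
    also have "\<dots> = K * (D - (\<Sum>x\<in>UNIV. delta G u x * d x))"
      by (simp add: sum_delta P)
    finally show "r u + (\<Sum>x\<in>UNIV. delta G u x * g x) \<le> g u - 1"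
      using lifts[OF u] P less[of u "\<Sum>x\<in>UNIV. delta G u x * d x"] by (simp add: lifts_def)
  next
    fix x assume "u \<in> V1 G" "x \<in> post G u"
    then show "r u + g x \<le> g u - 1"
      using lifts[OF u] less[of u "d x"] by (simp add: lifts_def g_def)
  next
    assume "u \<in> V2 G"
    then show "\<exists>x\<in>post G u. r u + g x \<le> g u - 1"
      using lifts[OF u] less[of u] by (auto simp: lifts_def g_def)
  qed
  moreover have "0 \<le> g u" for u using K D by (simp add: g_def)
  ultimately have "g \<in> strict_super"
    unfolding strict_super_def by (force intro!: exI[of _ 1])
  then show ?thesis by blast
qed

lemma game_value_le: "g \<in> strict_super \<Longrightarrow> game_value u \<le> g u"
  unfolding game_value_def by (intro cINF_lower bdd_belowI2[of _ 0]) (auto simp: strict_super_def)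

lemma game_value_greatest: "(\<And>g. g \<in> strict_super \<Longrightarrow> b \<le> g u) \<Longrightarrow> b \<le> game_value u"
  unfolding game_value_def by (intro cINF_greatest strict_super_nonempty)

lemma game_value_nonneg: "0 \<le> game_value u"
  by (rule game_value_greatest) (simp add: strict_super_def)

lemma game_value_approx:
  assumes e: "0 < e"
  obtains g where "g \<in> strict_super" "\<And>u. g u \<le> game_value u + e"
proof -
  have "\<exists>g\<in>strict_super. \<forall>u\<in>W. g u \<le> game_value u + e" if "finite W" for W
    using that
  proof induction
    case empty
    then show ?case using strict_super_nonempty by blast
  next
    case (insert w W)
    then obtain f where f: "f \<in> strict_super" "\<forall>u\<in>W. f u \<le> game_value u + e" by blast
    have "\<not> (\<forall>g\<in>strict_super. game_value w + e \<le> g w)"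
    proof
      assume "\<forall>g\<in>strict_super. game_value w + e \<le> g w"
      then have "game_value w + e \<le> game_value w" by (intro game_value_greatest) blast
      with e show False by simp
    qed
    then obtain g where g: "g \<in> strict_super" "g w \<le> game_value w + e" by (meson linear)
    show ?case
      using f g strict_super_min[OF f(1) g(1)]
      by (intro bexI[of _ "\<lambda>u. min (f u) (g u)"]) (auto simp: min_le_iff_disj)
  qed
  from this[of UNIV] show thesis using that by auto
qed

text \<open>One inequality is monotonicity. For the other, applying \<open>\<Gamma>\<close> to a
  nearly minimal \<open>g\<close> and adding a small margin gives a strictly superharmonic function
  again, and the infimum lies below it.\<close>

lemma \<Gamma>_value: "\<Gamma> G r game_value = game_value"
proof (intro ext antisym)
  fix u
  show "\<Gamma> G r game_value u \<le> game_value u"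
    using \<Gamma>_mono[OF game_value_le] strict_super_\<Gamma>_le by (intro game_value_greatest) (rule order_trans)
  show "game_value u \<le> \<Gamma> G r game_value u"
  proof (rule field_le_epsilon)
    fix e :: real assume e: "0 < e"
    obtain g where g: "g \<in> strict_super" "\<And>u. g u \<le> game_value u + e / 2"
      using game_value_approx[of "e / 2"] e by auto
    obtain \<epsilon> where \<epsilon>: "0 < \<epsilon>" "\<And>u. 0 \<le> g u" "\<And>u. u \<notin> terminal G \<Longrightarrow> \<Gamma> G r g u + \<epsilon> \<le> g u"
      using g(1) by (rule strict_superE) blast
    \<comment> \<open>The bound \<open>\<epsilon>\<close> keeps \<open>g'\<close> below
      \<open>g\<close>, so that \<open>\<eta>\<close> is a margin for \<open>g'\<close>; the bound
      \<open>e / 2\<close> pays for half of the allowed error.\<close>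
    define \<eta> where "\<eta> = min \<epsilon> (e / 2)"
    have \<eta>: "0 < \<eta>" "\<eta> \<le> \<epsilon>" "\<eta> \<le> e / 2" using \<epsilon>(1) e by (auto simp: \<eta>_def)
    define g' where "g' u = \<Gamma> G r g u + (if u \<in> terminal G then 0 else \<eta>)" for u
    have "g' u \<le> g u" for u
      using \<epsilon>(2,3)[of u] \<eta>(2) by (auto simp: g'_def \<Gamma>_terminal)
    then have "\<Gamma> G r g' u \<le> \<Gamma> G r g u" for u by (rule \<Gamma>_mono)
    then have "g' \<in> strict_super"
      using \<Gamma>_nonneg[OF \<epsilon>(2)] \<eta>(1) unfolding strict_super_def
      by (auto simp: g'_def intro!: exI[of _ \<eta>] add_nonneg_nonneg)
    then have "game_value u \<le> g' u" by (rule game_value_le)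
    also have "\<dots> \<le> \<Gamma> G r g u + e / 2" using \<eta> e by (simp add: g'_def)
    also have "\<Gamma> G r g u \<le> \<Gamma> G r game_value u + e / 2"
      using g(2) e by (intro \<Gamma>_shift) auto
    finally show "game_value u \<le> \<Gamma> G r game_value u + e" by simp
  qed
qed

section \<open>Lower and upper values and the greatest fixed point\<close>

text \<open>Stopping excludes fixed points sustained by reward-free cycles: almost surely
  \<open>f\<close> ends at 0, so its initial amount must be covered by collected rewards.\<close>

lemma fixed_point_le_expected_rew:
  assumes nonneg: "\<And>u. 0 \<le> f u" and fixed: "\<Gamma> G r f = f" and \<pi>2: "\<pi>2 \<in> strategies2_F G"
  shows "ennreal (f v) \<le> expected_rew G r (greedy1 f) \<pi>2 v"
  unfolding expected_rew_def rew_def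
proof (rule nn_integral_submartingale)
  have \<sigma>: "greedy1 f \<in> strategies1 G" using greedy1_strategies1_DM by (simp add: strategies1_DM_def)
  have \<pi>2': "\<pi>2 \<in> strategies2 G" using \<pi>2 by (simp add: strategies2_F_def)
  have f_terminal: "f u = 0" if "u \<in> terminal G" for u
    using fun_cong[OF fixed, of u] that by (simp add: \<Gamma>_terminal)
  show "ennreal (f u) \<le> ennreal (r u) + (\<integral>\<^sup>+x. ennreal (f x) \<partial>next_vertex G (greedy1 f) \<pi>2 h u)" for h u
  proof (cases "u \<in> terminal G")
    case True
    then show ?thesis by (simp add: f_terminal)
  next
    case False
    have "ennreal (\<Gamma> G r f u) \<le> ennreal (r u) + (\<integral>\<^sup>+x. ennreal (f x) \<partial>next_vertex G (greedy1 f) \<pi>2 h u)"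
      by (rule nn_integral_next_vertex_greedy1[OF \<pi>2' False nonneg r_nonneg])
    then show ?thesis by (simp add: fixed)
  qed
  show "AE \<omega> in path_measure G (greedy1 f) \<pi>2 v. \<forall>\<^sub>F n in sequentially. ennreal (f (\<omega> n)) = 0"
    using AE_reach_terminal[OF \<sigma> \<pi>2]
  proof eventually_elim
    case (elim \<omega>)
    then obtain i where i: "\<omega> \<in> paths G" "\<omega> i \<in> terminal G" by (auto simp: reach_terminal_def)
    have "ennreal (f (\<omega> n)) = 0" if "i \<le> n" for n
      unfolding path_absorbed[OF i that] f_terminal[OF i(2)] by simp
    then show ?case unfolding eventually_sequentially by blast
  qed
qed simp

lemma fixed_point_le_lower_value:
  assumes "\<And>u. 0 \<le> f u" "\<Gamma> G r f = f"
  shows "ennreal (f v) \<le> (SUP \<pi>1 \<in> strategies1 G. INF \<pi>2 \<in> strategies2_F G. expected_rew G r \<pi>1 \<pi>2 v)"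
  using fixed_point_le_expected_rew[OF assms] greedy1_strategies1_DM
  by (intro SUP_upper2[of "greedy1 f"] INF_greatest) (auto simp: strategies1_DM_def)

text \<open>Minimising \<open>game_value\<close> itself may cycle, so Player 2 instead minimises a
  strictly superharmonic function within \<open>e\<close> of it; that strategy is fair.\<close>

lemma upper_value_le_value:
  "(INF \<pi>2 \<in> strategies2_F G. SUP \<pi>1 \<in> strategies1 G. expected_rew G r \<pi>1 \<pi>2 v) \<le> ennreal (game_value v)"
proof (rule ennreal_le_epsilon)
  fix e :: real assume e: "0 < e"
  obtain g where g: "g \<in> strict_super" "\<And>u. g u \<le> game_value u + e"
    using game_value_approx[OF e] by blast
  have "(INF \<pi>2 \<in> strategies2_F G. SUP \<pi>1 \<in> strategies1 G. expected_rew G r \<pi>1 \<pi>2 v) \<le> ennreal (g v)"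
    by (intro INF_lower2[OF greedy2_fair[OF g(1)]] SUP_least greedy2_strict_super g)
  also have "\<dots> \<le> ennreal (game_value v) + ennreal e"
    unfolding ennreal_plus[OF game_value_nonneg less_imp_le[OF e], symmetric] by (intro ennreal_leI g)
  finally show "(INF \<pi>2 \<in> strategies2_F G. SUP \<pi>1 \<in> strategies1 G. expected_rew G r \<pi>1 \<pi>2 v)
    \<le> ennreal (game_value v) + ennreal e" .
qed

lemma lower_value_le_upper_value:
  "(SUP \<pi>1 \<in> strategies1 G. INF \<pi>2 \<in> strategies2_F G. expected_rew G r \<pi>1 \<pi>2 v)
    \<le> (INF \<pi>2 \<in> strategies2_F G. SUP \<pi>1 \<in> strategies1 G. expected_rew G r \<pi>1 \<pi>2 v)"
  by (intro SUP_least INF_greatest) (rule INF_lower2, assumption, rule SUP_upper)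

text \<open>The maximising strategy of Player 1 is positional and works against every fair opponent,
  so its guarantee survives the restriction to the strategy classes in
  \<open>upper_bound\<close>.\<close>

lemma game_value_in_value_lattice: "game_value \<in> value_lattice G r"
proof -
  have "ennreal (game_value v) \<le> upper_bound G r" for v
  proof -
    have "ennreal (game_value v) \<le> (INF \<pi>2 \<in> strategies2_DMF G. SUP \<pi>1 \<in> strategies1_DM G. expected_rew G r \<pi>1 \<pi>2 v)"
      using greedy1_strategies1_DM fixed_point_le_expected_rew[OF game_value_nonneg \<Gamma>_value]
      by (intro INF_greatest SUP_upper2[of "greedy1 game_value"]) (auto simp: strategies2_DMF_def)
    also have "\<dots> \<le> upper_bound G r"
      unfolding upper_bound_def by (intro Max_ge) auto
    finally show ?thesis .
  qed
  then show ?thesis by (simp add: value_lattice_def game_value_nonneg)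
qed

lemma nu_\<Gamma>_eq_value: "nu_\<Gamma> G r = game_value"
  unfolding nu_\<Gamma>_def
proof (rule Greatest_equality)
  show "game_value \<in> value_lattice G r \<and> \<Gamma> G r game_value = game_value"
    using game_value_in_value_lattice \<Gamma>_value by simp
next
  fix f assume "f \<in> value_lattice G r \<and> \<Gamma> G r f = f"
  then have f: "\<And>u. 0 \<le> f u" "\<Gamma> G r f = f" by (auto simp: value_lattice_def)
  show "f \<le> game_value"
  proof (rule le_funI)
    fix v
    have "ennreal (f v) \<le> ennreal (game_value v)"
      by (rule order_trans[OF fixed_point_le_lower_value[OF f]
            order_trans[OF lower_value_le_upper_value upper_value_le_value]])
    then show "f v \<le> game_value v" by (simp add: game_value_nonneg)
  qed
qed

end

theorem theorem10:
  fixes G :: "'v::finite game" and r :: "'v \<Rightarrow> real" and v :: 'v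
  assumes "stochastic_game G"
    and "reward_function G r"
    and "stopping_under_fairness G"
  shows "(INF \<pi>2 \<in> strategies2_F G. SUP \<pi>1 \<in> strategies1 G. expected_rew G r \<pi>1 \<pi>2 v)
           = (SUP \<pi>1 \<in> strategies1 G. INF \<pi>2 \<in> strategies2_F G. expected_rew G r \<pi>1 \<pi>2 v)
       \<and> (SUP \<pi>1 \<in> strategies1 G. INF \<pi>2 \<in> strategies2_F G. expected_rew G r \<pi>1 \<pi>2 v)
           = ennreal (nu_\<Gamma> G r v)"
proof -
  interpret stopping_reward_game G r
    using assms by unfold_locales
  \<comment> \<open>The three inequalities close a cycle through the game value and the lower and
    upper values.\<close>
  from fixed_point_le_lower_value[OF game_value_nonneg \<Gamma>_value, of v] lower_value_le_upper_value[of v]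
    upper_value_le_value[of v]
  show ?thesis unfolding nu_\<Gamma>_eq_value by (intro conjI) order+
qed

end
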